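(* $\tilde{r}(P_3,P_3,P_3)\le 4$ and $\tilde{r}(P_3,P_3,P_4)\le 6$.
   Context: $P_m$ denotes the path on $m$ vertices. The three-color online Ramsey game for graphs $G_1,G_2,G_3$ is played by Builder and Painter on an infinite vertex set with initially no edges. In each round Builder draws an edge between two currently nonadjacent vertices, and Painter immediately colors it red, blue or green. Builder wins once the colored graph contains a red copy of $G_1$, a blue copy of $G_2$, or a green copy of $G_3$. The online Ramsey number $\tilde{r}(G_1,G_2,G_3)$ is the minimum number of rounds within which Builder can guarantee a win against every strategy of Painter. *)

theory Defs
  imports Main "HOL-Library.Extended_Nat"
begin

text \<open>Simple graphs are pairs of a vertex set and a set of two-element edges.\<close>

type_synonym 'a graph = "'a set \<times> 'a set set"

definition path_graph :: "nat \<Rightarrow> nat graph" where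
  "path_graph m = ({..<m}, {{i, Suc i} | i. Suc i < m})"

text \<open>A copy is a subgraph, not necessarily induced.\<close>

definition contains_copy :: "'v graph \<Rightarrow> 'a graph \<Rightarrow> bool" where
  "contains_copy H G \<longleftrightarrow>
     (\<exists>f. inj_on f (fst G) \<and> f ` fst G \<subseteq> fst H \<and> (\<forall>e \<in> snd G. f ` e \<in> snd H))"

datatype color = Red | Blue | Green

text \<open>A history lists the drawn edges with their colors in chronological order.\<close>

type_synonym 'v history = "('v set \<times> color) list"

definition drawn_edges :: "'v history \<Rightarrow> 'v set set" where
  "drawn_edges h = fst ` set h"

definition color_graph :: "'v set \<Rightarrow> 'v history \<Rightarrow> color \<Rightarrow> 'v graph" where
  "color_graph V h c = (V, {e. (e, c) \<in> set h})"

definition builder_won ::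
  "'v set \<Rightarrow> 'a graph \<Rightarrow> 'b graph \<Rightarrow> 'c graph \<Rightarrow> 'v history \<Rightarrow> bool" where
  "builder_won V G1 G2 G3 h \<longleftrightarrow>
     contains_copy (color_graph V h Red) G1 \<or>
     contains_copy (color_graph V h Blue) G2 \<or>
     contains_copy (color_graph V h Green) G3"

type_synonym 'v builder = "'v history \<Rightarrow> 'v set"
type_synonym 'v painter = "'v history \<Rightarrow> 'v set \<Rightarrow> color"

text \<open>Histories are finite, so on an infinite vertex set a legal edge exists after every history.\<close>

definition legal_builder :: "'v set \<Rightarrow> 'v builder \<Rightarrow> bool" where
  "legal_builder V b \<longleftrightarrow>
     (\<forall>h. \<exists>u \<in> V. \<exists>v \<in> V. u \<noteq> v \<and> {u, v} \<notin> drawn_edges h \<and> b h = {u, v})"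

fun play :: "'v builder \<Rightarrow> 'v painter \<Rightarrow> nat \<Rightarrow> 'v history" where
  "play b p 0 = []"
| "play b p (Suc n) = (let h = play b p n; e = b h in h @ [(e, p h e)])"

definition builder_wins_within ::
  "'v set \<Rightarrow> 'a graph \<Rightarrow> 'b graph \<Rightarrow> 'c graph \<Rightarrow> nat \<Rightarrow> bool" where
  "builder_wins_within V G1 G2 G3 n \<longleftrightarrow>
     (\<exists>b. legal_builder V b \<and> (\<forall>p. \<exists>k \<le> n. builder_won V G1 G2 G3 (play b p k)))"

text \<open>The value is \<open>\<infinity>\<close> if Builder cannot force a win within any fixed number of rounds.\<close>

definition online_ramsey ::
  "'v set \<Rightarrow> 'a graph \<Rightarrow> 'b graph \<Rightarrow> 'c graph \<Rightarrow> enat" where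
  "online_ramsey V G1 G2 G3 = Inf {enat n | n. builder_wins_within V G1 G2 G3 n}"

end

theory Submission
  imports Defs
begin

text \<open>
  Four edges at a common vertex contain two of the same color, which settles the first bound.

  For the second bound, Builder draws three edges \<open>ab\<close>, \<open>ac\<close>, \<open>ad\<close>. If all are green, he completes
  the \<open>K\<^sub>4\<close>: none of \<open>bc\<close>, \<open>bd\<close>, \<open>cd\<close> can be green, and two of them share a color. Otherwise he draws
  a fourth edge \<open>ae\<close>. As red and blue occur at most once each at \<open>a\<close>, there are two green edges \<open>ay\<close>,
  \<open>az\<close> and an edge \<open>ax\<close> that is not green. Painter can color \<open>yx\<close> neither green nor like \<open>ax\<close>, and
  then every color of \<open>zx\<close> loses.
\<close>

section \<open>From winning positions to strategies\<close>

text \<open>Backward induction on the rounds left: quantifying over the color of each single answer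
  replaces the quantifier over whole strategies of Painter, so a win becomes a finite case
  analysis.\<close>

primrec can_force :: "'v set \<Rightarrow> ('v history \<Rightarrow> bool) \<Rightarrow> nat \<Rightarrow> 'v history \<Rightarrow> bool" where
  "can_force V W 0 h \<longleftrightarrow> W h"
| "can_force V W (Suc n) h \<longleftrightarrow> W h \<or>
     (\<exists>u\<in>V. \<exists>v\<in>V. u \<noteq> v \<and> {u, v} \<notin> drawn_edges h \<and> (\<forall>c. can_force V W n (h @ [({u, v}, c)])))"

lemma can_force_won: "W h \<Longrightarrow> can_force V W n h"
  by (cases n) auto

lemma can_force_step:
  assumes "u \<in> V" "v \<in> V" "u \<noteq> v" "{u, v} \<notin> drawn_edges h"
    and "\<And>c. can_force V W n (h @ [({u, v}, c)])"
  shows "can_force V W (Suc n) h"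
  unfolding can_force.simps using assms by blast

lemma length_play [simp]: "length (play b p n) = n"
  by (induction n) (auto simp: Let_def)

text \<open>A fixed vertex has infinitely many possible edges, and only finitely many are drawn.
  This matters because \<open>legal_builder\<close> asks for a legal answer to every history, even
  one that no play reaches.\<close>

lemma legal_edge_exists:
  assumes "infinite V"
  shows "\<exists>u\<in>V. \<exists>v\<in>V. u \<noteq> v \<and> {u, v} \<notin> drawn_edges h"
proof -
  obtain u where u: "u \<in> V"
    using infinite_imp_nonempty[OF assms] by blast
  have "infinite ((\<lambda>v. {u, v}) ` (V - {u}))"
  proof
    assume "finite ((\<lambda>v. {u, v}) ` (V - {u}))"
    moreover have "inj_on (\<lambda>v. {u, v}) (V - {u})"
      by (simp add: inj_on_def doubleton_eq_iff)
    ultimately show False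
      using assms by (simp add: finite_image_iff)
  qed
  moreover have "finite (drawn_edges h)"
    by (simp add: drawn_edges_def)
  ultimately have "\<not> (\<lambda>v. {u, v}) ` (V - {u}) \<subseteq> drawn_edges h"
    by (metis finite_subset)
  then obtain v where "v \<in> V" "v \<noteq> u" "{u, v} \<notin> drawn_edges h"
    by (auto simp: image_subset_iff)
  then show ?thesis
    using u by metis
qed

text \<open>Builder always picks an edge that keeps the position winning; the color that Painter
  answers with is one instance of the quantifier over \<open>c\<close>.\<close>

lemma builder_wins_within_if_can_force:
  assumes "infinite V" and "can_force V (builder_won V G1 G2 G3) n []"
  shows "builder_wins_within V G1 G2 G3 n"
proof -
  let ?W = "builder_won V G1 G2 G3"
  define legal where
    "legal h e \<longleftrightarrow> (\<exists>u\<in>V. \<exists>v\<in>V. u \<noteq> v \<and> {u, v} \<notin> drawn_edges h \<and> e = {u, v})" for h and e :: "'a set"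
  \<comment> \<open>A strategy sees only the history, so the number of rounds left is recovered from
    its length.\<close>
  define good where
    "good h e \<longleftrightarrow> legal h e \<and> (\<forall>c. can_force V ?W (n - Suc (length h)) (h @ [(e, c)]))" for h e
  \<comment> \<open>Where no good edge exists, an arbitrary legal one keeps \<open>b\<close>
    legal.\<close>
  define b where "b h = (if \<exists>e. good h e then SOME e. good h e else SOME e. legal h e)" for h
  have good_b: "good h (b h)" if "good h e" for h e
    using that unfolding b_def by (metis someI)
  have "legal h (b h)" for h
  proof (cases "\<exists>e. good h e")
    case True
    then show ?thesis
      using good_b by (auto simp: good_def)
  next
    case False
    moreover have "\<exists>e. legal h e"
      using legal_edge_exists[OF assms(1)] unfolding legal_def by blast
    ultimately show ?thesis
      unfolding b_def by (metis someI)
  qed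
  then have "legal_builder V b"
    by (simp add: legal_builder_def legal_def)
  moreover have "\<exists>k\<le>n. ?W (play b p k)" for p
  proof (rule ccontr)
    assume no: "\<not> ?thesis"
    \<comment> \<open>Invariant along a play without a win: the early-win disjunct of
      \<open>can_force\<close> is excluded, so a good edge exists. At \<open>k = n\<close> no rounds
      are left and the invariant is itself a win.\<close>
    have "can_force V ?W (n - k) (play b p k)" if "k \<le> n" for k
      using that
    proof (induction k)
      case 0
      then show ?case
        using assms(2) by simp
    next
      case (Suc k)
      let ?h = "play b p k"
      have "n - k = Suc (n - Suc k)"
        using Suc.prems by simp
      then have "can_force V ?W (Suc (n - Suc k)) ?h"
        using Suc by simp
      moreover have "\<not> ?W ?h"
        using no Suc.prems by auto
      ultimately have "\<exists>e. good ?h e"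
        unfolding good_def legal_def by auto
      then have "good ?h (b ?h)"
        using good_b by blast
      then show ?case
        by (simp add: good_def Let_def)
    qed
    from this[of n] show False
      using no by auto
  qed
  ultimately show ?thesis
    unfolding builder_wins_within_def by blast
qed

lemma online_ramsey_le_if_can_force:
  assumes "infinite V" and "can_force V (builder_won V G1 G2 G3) n []"
  shows "online_ramsey V G1 G2 G3 \<le> enat n"
  unfolding online_ramsey_def
  using builder_wins_within_if_can_force[OF assms] by (intro Inf_lower) blast

section \<open>Short monochromatic paths and a supply of vertices\<close>

lemma path_graph_3: "path_graph 3 = ({0, 1, 2}, {{0, 1}, {1, 2}})"
proof -
  have "{i. Suc i < 3} = {0, 1}" and "{..<3::nat} = {0, 1, 2}"
    by auto
  then show ?thesis
    unfolding path_graph_def setcompr_eq_image by (simp add: numeral_2_eq_2 numeral_3_eq_3)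
qed

lemma path_graph_4: "path_graph 4 = ({0, 1, 2, 3}, {{0, 1}, {1, 2}, {2, 3}})"
proof -
  have "{i. Suc i < 4} = {0, 1, 2}" and "{..<4::nat} = {0, 1, 2, 3}"
    by auto
  then show ?thesis
    unfolding path_graph_def setcompr_eq_image by (simp add: numeral_2_eq_2 numeral_3_eq_3)
qed

lemma contains_path3:
  assumes "({x, y}, c) \<in> set h" "({y, z}, c) \<in> set h" "distinct [x, y, z]" "{x, y, z} \<subseteq> V"
  shows "contains_copy (color_graph V h c) (path_graph 3)"
  using assms unfolding contains_copy_def path_graph_3 color_graph_def
  \<comment> \<open>List indexing sends vertex \<open>i\<close> of the path to entry
    \<open>i\<close>; distinctness makes it injective.\<close>
  by (intro exI[of _ "(!) [x, y, z]"]) simp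

lemma contains_path4:
  assumes "({w, x}, c) \<in> set h" "({x, y}, c) \<in> set h" "({y, z}, c) \<in> set h"
    and "distinct [w, x, y, z]" "{w, x, y, z} \<subseteq> V"
  shows "contains_copy (color_graph V h c) (path_graph 4)"
  using assms unfolding contains_copy_def path_graph_4 color_graph_def
  by (intro exI[of _ "(!) [w, x, y, z]"]) simp

text \<open>The path has center \<open>y\<close>. If it is red or blue, it wins whatever the green
  target \<open>G\<close> is, so the second claim serves the second game.\<close>

lemma builder_won_path3:
  assumes "({y, x}, c) \<in> set h" "({y, z}, c) \<in> set h" "distinct [x, y, z]" "{x, y, z} \<subseteq> V"
  shows "builder_won V (path_graph 3) (path_graph 3) (path_graph 3) h"
    and "c \<noteq> Green \<Longrightarrow> builder_won V (path_graph 3) (path_graph 3) G h"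
  using contains_path3[of x y c h z V] assms
  by (cases c; auto simp: builder_won_def insert_commute)+

text \<open>The path is z-a-x-y: two edges of the star at \<open>a\<close>, prolonged by
  \<open>xy\<close>.\<close>

lemma builder_won_green_path4:
  assumes "({a, z}, Green) \<in> set h" "({a, x}, Green) \<in> set h" "({x, y}, Green) \<in> set h"
    and "distinct [a, x, y, z]" "{a, x, y, z} \<subseteq> V"
  shows "builder_won V G1 G2 (path_graph 4) h"
  using contains_path4[of z a Green h x y V] assms
  by (auto simp: builder_won_def insert_commute[of z a])

lemma exists_5_distinct:
  assumes "infinite V"
  obtains a b c d e where "distinct [a, b, c, d, e]" "{a, b, c, d, e} \<subseteq> V"
proof -
  obtain A where "A \<subseteq> V" "finite A" "card A = 5"
    using infinite_arbitrarily_large[OF assms] by metis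
  moreover from this obtain xs where "set xs = A" "length xs = 5" "distinct xs"
    by (metis finite_distinct_list distinct_card)
  moreover from this obtain a b c d e where "xs = [a, b, c, d, e]"
    by (auto simp: length_Suc_conv eval_nat_numeral)
  ultimately show ?thesis
    using that by auto
qed

section \<open>The bound for P_3, P_3, P_3\<close>

lemma can_force_P3_P3_P3:
  assumes "infinite V"
  shows "can_force V (builder_won V (path_graph 3) (path_graph 3) (path_graph 3)) 4 []"
proof -
  obtain a b c d e where dist: "distinct [a, b, c, d, e]" and sub: "{a, b, c, d, e} \<subseteq> V"
    using exists_5_distinct[OF assms] .
  let ?W = "builder_won V (path_graph 3) (path_graph 3) (path_graph 3)"
  have won: "?W [({a, b}, c1), ({a, c}, c2), ({a, d}, c3), ({a, e}, c4)]" (is "builder_won _ _ _ _ ?h") for c1 c2 c3 c4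
  proof -
    have *: "?W ?h"
      if "({a, x}, k) \<in> set ?h" "({a, y}, k) \<in> set ?h" "x \<noteq> y" "{x, y} \<subseteq> {b, c, d, e}" for x y k
      by (rule builder_won_path3(1)[of a x k ?h y V]) (use that dist sub in auto)
    have "b \<noteq> c" "b \<noteq> d" "b \<noteq> e" "c \<noteq> d" "c \<noteq> e" "d \<noteq> e"
      using dist by auto
    note ** = *[of b c1 c] *[of b c1 d] *[of b c1 e] *[of c c2 d] *[of c c2 e] *[of d c3 e] this
    consider "c1 = c2" | "c1 = c3" | "c1 = c4" | "c2 = c3" | "c2 = c4" | "c3 = c4"
      by (metis color.exhaust)
    then show ?thesis
      using ** by cases simp_all
  qed
  \<comment> \<open>The edges do not depend on the colors, so \<open>won\<close> for all colorings
    suffices.\<close>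
  have "can_force V ?W (Suc (Suc (Suc (Suc 0)))) []"
    apply (rule can_force_step[of a V b])
    using dist sub apply (auto simp: drawn_edges_def)[4]
    apply (rule can_force_step[of a V c])
    using dist sub apply (auto simp: drawn_edges_def doubleton_eq_iff)[4]
    apply (rule can_force_step[of a V d])
    using dist sub apply (auto simp: drawn_edges_def doubleton_eq_iff)[4]
    apply (rule can_force_step[of a V e])
    using dist sub apply (auto simp: drawn_edges_def doubleton_eq_iff)[4]
    using won by simp
  then show ?thesis
    by (simp add: eval_nat_numeral del: can_force.simps)
qed

section \<open>The bound for P_3, P_3, P_4\<close>

context
  fixes V :: "'v set" and W :: "'v history \<Rightarrow> bool"
  defines "W \<equiv> builder_won V (path_graph 3) (path_graph 3) (path_graph 4)"
begin

lemma can_force_two_green_one_other: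
  assumes "({a, x}, k) \<in> set h" "k \<noteq> Green" "({a, y}, Green) \<in> set h" "({a, z}, Green) \<in> set h"
    and dist: "distinct [a, x, y, z]" and sub: "{a, x, y, z} \<subseteq> V"
    and "{y, x} \<notin> drawn_edges h" "{z, x} \<notin> drawn_edges h"
  shows "can_force V W (Suc (Suc 0)) h"
proof (rule can_force_step[of y V x])
  fix c
  let ?h = "h @ [({y, x}, c)]"
  show "can_force V W (Suc 0) ?h"
  \<comment> \<open>Color \<open>k\<close> closes the path a-x-y, and green closes z-a-y-x.\<close>
  proof (cases "c = k \<or> c = Green")
    case True
    then have "W ?h"
      unfolding W_def
      using builder_won_path3(2)[of x a k ?h y V "path_graph 4"]
        builder_won_green_path4[of a z ?h y x V "path_graph 3" "path_graph 3"] assms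
      by (auto simp: insert_commute[of x])
    then show ?thesis
      by (rule can_force_won)
  next
    case c: False
    show ?thesis
    proof (rule can_force_step[of z V x])
      fix c'
      let ?h' = "?h @ [({z, x}, c')]"
      \<comment> \<open>Now \<open>Green\<close>, \<open>k\<close> and \<open>c\<close> are all
        three colors; they close the paths y-a-z-x, a-x-z and y-x-z, respectively.\<close>
      consider "c' = Green" | "c' = k" | "c' = c"
        using c assms(2) by (metis color.exhaust)
      then have "W ?h'"
        unfolding W_def
        using builder_won_path3(2)[of x a k ?h' z V "path_graph 4"]
          builder_won_path3(2)[of x y c ?h' z V "path_graph 4"]
          builder_won_green_path4[of a y ?h' z x V "path_graph 3" "path_graph 3"] assms c
        by cases (auto simp: insert_commute[of x])
      then show "can_force V W 0 ?h'"
        by simp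
    qed (use assms in \<open>auto simp: drawn_edges_def doubleton_eq_iff\<close>)
  qed
qed (use assms in auto)

lemma can_force_three_green:
  assumes "({a, x}, Green) \<in> set h" "({a, y}, Green) \<in> set h" "({a, z}, Green) \<in> set h"
    and dist: "distinct [a, x, y, z]" and sub: "{a, x, y, z} \<subseteq> V"
    and "{x, y} \<notin> drawn_edges h" "{x, z} \<notin> drawn_edges h" "{y, z} \<notin> drawn_edges h"
  shows "can_force V W (Suc (Suc (Suc 0))) h"
proof -
  have won: "W (h @ [({x, y}, c1), ({x, z}, c2), ({y, z}, c3)])" (is "W ?h") for c1 c2 c3
  proof -
    \<comment> \<open>A green edge prolongs the green star to a P_4. Otherwise two colors serve
      three edges of a triangle, any two of which share a vertex.\<close>
    consider "c1 = Green" | "c2 = Green" | "c3 = Green"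
      | "c1 = c2" "c1 \<noteq> Green" | "c1 = c3" "c1 \<noteq> Green" | "c2 = c3" "c2 \<noteq> Green"
      by (metis color.exhaust)
    moreover have "y \<noteq> x" "z \<noteq> x" "z \<noteq> y"
      using dist by auto
    ultimately show ?thesis
      unfolding W_def
      using builder_won_path3(2)[of x y c1 ?h z V "path_graph 4"]
        builder_won_path3(2)[of y x c1 ?h z V "path_graph 4"]
        builder_won_path3(2)[of z x c2 ?h y V "path_graph 4"]
        builder_won_green_path4[of a z ?h x y V "path_graph 3" "path_graph 3"]
        builder_won_green_path4[of a y ?h x z V "path_graph 3" "path_graph 3"]
        builder_won_green_path4[of a x ?h y z V "path_graph 3" "path_graph 3"] assms
      by cases (simp_all add: insert_commute[of y x] insert_commute[of z x] insert_commute[of z y])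
  qed
  show ?thesis
    apply (rule can_force_step[of x V y])
    using assms apply (auto simp: drawn_edges_def)[4]
    apply (rule can_force_step[of x V z])
    using assms apply (auto simp: drawn_edges_def doubleton_eq_iff)[4]
    apply (rule can_force_step[of y V z])
    using assms apply (auto simp: drawn_edges_def doubleton_eq_iff)[4]
    using won by simp
qed

lemma can_force_P3_P3_P4:
  assumes "infinite V"
  shows "can_force V W 6 []"
proof -
  obtain a b c d e where dist: "distinct [a, b, c, d, e]" and sub: "{a, b, c, d, e} \<subseteq> V"
    using exists_5_distinct[OF assms] .
  have four: "can_force V W (Suc (Suc 0)) [({a, b}, c1), ({a, c}, c2), ({a, d}, c3), ({a, e}, c4)]"
    (is "can_force V W _ ?h") if not_green: "\<not> (c1 = Green \<and> c2 = Green \<and> c3 = Green)" for c1 c2 c3 c4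
  proof -
    have same: "can_force V W (Suc (Suc 0)) ?h"
      if "({a, x}, k) \<in> set ?h" "({a, y}, k) \<in> set ?h" "k \<noteq> Green" "x \<noteq> y" "{x, y} \<subseteq> {b, c, d, e}" for x y k
      using builder_won_path3(2)[of a x k ?h y V "path_graph 4"] that sub dist
      by (intro can_force_won) (auto simp: W_def)
    have two: "can_force V W (Suc (Suc 0)) ?h"
      if "({a, x}, k) \<in> set ?h" "({a, y}, Green) \<in> set ?h" "({a, z}, Green) \<in> set ?h"
        "k \<noteq> Green" "distinct [x, y, z]" "{x, y, z} \<subseteq> {b, c, d, e}" for x y z k
      by (rule can_force_two_green_one_other[of a x k ?h y z])
        (use that dist sub in \<open>auto simp: drawn_edges_def doubleton_eq_iff\<close>)
    \<comment> \<open>The six pairs of edges that may share a non-green color; if none does, at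
      least two of the four edges are green.\<close>
    note same' = same[of b c1 c] same[of b c1 d] same[of b c1 e] same[of c c2 d] same[of c c2 e]
      same[of d c3 e]
    \<comment> \<open>All twelve choices of a non-green edge and two green ones.
      \<open>not_green\<close> excludes four green edges, which would leave no non-green
      one.\<close>
    note two' = two[of b c1 c d] two[of b c1 c e] two[of b c1 d e] two[of c c2 b d] two[of c c2 b e]
      two[of c c2 d e] two[of d c3 b c] two[of d c3 b e] two[of d c3 c e] two[of e c4 b c]
      two[of e c4 b d] two[of e c4 c d]
    have ne: "b \<noteq> c" "b \<noteq> d" "b \<noteq> e" "c \<noteq> d" "c \<noteq> e" "d \<noteq> e"
      using dist by auto
    show ?thesis
      using same' two' ne ne[symmetric] not_green
      by (cases c1; cases c2; cases c3; cases c4) (simp_all del: can_force.simps)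
  qed
  \<comment> \<open>Here Builder first reacts to the colors. Both branches take at most three more
    rounds: the triangle, or \<open>ae\<close> and then two edges.\<close>
  have three: "can_force V W (Suc (Suc (Suc 0))) [({a, b}, c1), ({a, c}, c2), ({a, d}, c3)]"
    (is "can_force V W _ ?h") for c1 c2 c3
  proof (cases "c1 = Green \<and> c2 = Green \<and> c3 = Green")
    case True
    then show ?thesis
      by (intro can_force_three_green[of a b _ c d])
        (use dist sub in \<open>auto simp: drawn_edges_def doubleton_eq_iff\<close>)
  next
    case False
    show ?thesis
    proof (rule can_force_step[of a V e])
      show "can_force V W (Suc (Suc 0)) (?h @ [({a, e}, c4)])" for c4
        using four[OF False, of c4] by (simp del: can_force.simps)
    qed (use dist sub in \<open>auto simp: drawn_edges_def doubleton_eq_iff\<close>)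
  qed
  have "can_force V W (Suc (Suc (Suc (Suc (Suc (Suc 0)))))) []"
    apply (rule can_force_step[of a V b])
    using dist sub apply (auto simp: drawn_edges_def)[4]
    apply (rule can_force_step[of a V c])
    using dist sub apply (auto simp: drawn_edges_def doubleton_eq_iff)[4]
    apply (rule can_force_step[of a V d])
    using dist sub apply (auto simp: drawn_edges_def doubleton_eq_iff)[4]
    using three by (simp del: can_force.simps)
  then show ?thesis
    by (simp add: eval_nat_numeral del: can_force.simps)
qed

end

theorem theorem3p11:
  fixes V :: "'v set"
  assumes "infinite V"
  shows "online_ramsey V (path_graph 3) (path_graph 3) (path_graph 3) \<le> 4 \<and>
         online_ramsey V (path_graph 3) (path_graph 3) (path_graph 4) \<le> 6"
  using online_ramsey_le_if_can_force[OF assms can_force_P3_P3_P3[OF assms]]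
    online_ramsey_le_if_can_force[OF assms can_force_P3_P3_P4[OF assms]]
  by (simp add: numeral_eq_enat)

end
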